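(* Let $G$ be a graph with $n$ vertices, and let $b,\Delta,a,m$ be non-negative integers with $b-\Delta\ge a\ge 2$, $\delta(G)\ge\frac{(\Delta+a)n}{b+2a+\Delta}+\frac{b(b-\Delta)}{a+\Delta}+m$ and $n>\frac{(b+2m+a-2)(b+\Delta+2a)}{\Delta+a}$. Let $g,f$ be integer-valued functions on $V(G)$ with $b-\Delta\ge f(x)-\Delta\ge g(x)\ge a$ for every vertex $x$. If $\sigma_2(G)\ge\frac{2(b+a)n}{b+2a+\Delta}$, then $G$ is fractional ID-$(g,f,m)$-deleted.
   Context: All graphs are finite and simple; $\delta(G)$ is the minimum degree and $\sigma_2(G)=\min\{d_G(u)+d_G(v): u\ne v,\ uv\notin E(G)\}$. For integer-valued functions $g\le f$ on $V(G)$, a fractional $(g,f)$-factor of $G$ is a function $h:E(G)\to[0,1]$ such that $g(x)\le\sum_{e\ni x}h(e)\le f(x)$ for every vertex $x$. $G$ is fractional $(g,f,m)$-deleted if for every $H\subseteq E(G)$ with $|H|=m$, $G-H$ has a fractional $(g,f)$-factor. $G$ is fractional ID-$(g,f,m)$-deleted if for every independent set $I\subseteq V(G)$, $G-I$ is fractional $(g,f,m)$-deleted (with $g,f$ restricted to $V(G)\setminus I$). *)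

theory Defs
  imports Complex_Main "HOL-Library.Extended_Real"
begin

text \<open>A graph is given by its vertex set and its set of edges, an edge being the
  two-element set of its ends.\<close>

definition finite_simple_graph :: "'a set \<Rightarrow> 'a set set \<Rightarrow> bool" where
  "finite_simple_graph V E \<longleftrightarrow> finite V \<and> (\<forall>e\<in>E. e \<subseteq> V \<and> card e = 2)"

definition degree :: "'a set set \<Rightarrow> 'a \<Rightarrow> nat" where
  "degree E x = card {e \<in> E. x \<in> e}"

definition min_degree :: "'a set \<Rightarrow> 'a set set \<Rightarrow> nat" where
  "min_degree V E = Min (degree E ` V)"

text \<open>The value is extended real so that, by the usual convention for a minimum over
  no pairs, it is \<open>\<infinity>\<close> for a complete graph. On a finite graph with a non-adjacent
  pair the infimum is attained.\<close>

definition sigma2 :: "'a set \<Rightarrow> 'a set set \<Rightarrow> ereal" where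
  "sigma2 V E = Inf {ereal (real (degree E u + degree E v)) | u v.
     u \<in> V \<and> v \<in> V \<and> u \<noteq> v \<and> {u, v} \<notin> E}"

definition independent_set :: "'a set \<Rightarrow> 'a set set \<Rightarrow> 'a set \<Rightarrow> bool" where
  "independent_set V E I \<longleftrightarrow> I \<subseteq> V \<and> (\<forall>u\<in>I. \<forall>v\<in>I. {u, v} \<notin> E)"

definition fractional_factor ::
    "'a set \<Rightarrow> 'a set set \<Rightarrow> ('a \<Rightarrow> int) \<Rightarrow> ('a \<Rightarrow> int) \<Rightarrow> ('a set \<Rightarrow> real) \<Rightarrow> bool" where
  "fractional_factor V E g f h \<longleftrightarrow>
     (\<forall>e\<in>E. 0 \<le> h e \<and> h e \<le> 1) \<and>
     (\<forall>x\<in>V. real_of_int (g x) \<le> (\<Sum>e | e \<in> E \<and> x \<in> e. h e) \<and>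
             (\<Sum>e | e \<in> E \<and> x \<in> e. h e) \<le> real_of_int (f x))"

definition fractional_deleted ::
    "'a set \<Rightarrow> 'a set set \<Rightarrow> ('a \<Rightarrow> int) \<Rightarrow> ('a \<Rightarrow> int) \<Rightarrow> nat \<Rightarrow> bool" where
  "fractional_deleted V E g f m \<longleftrightarrow>
     (\<forall>H. H \<subseteq> E \<and> card H = m \<longrightarrow> (\<exists>h. fractional_factor V (E - H) g f h))"

definition fractional_ID_deleted ::
    "'a set \<Rightarrow> 'a set set \<Rightarrow> ('a \<Rightarrow> int) \<Rightarrow> ('a \<Rightarrow> int) \<Rightarrow> nat \<Rightarrow> bool" where
  "fractional_ID_deleted V E g f m \<longleftrightarrow>
     (\<forall>I. independent_set V E I \<longrightarrow>
        fractional_deleted (V - I) {e \<in> E. e \<inter> I = {}} g f m)"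

end

theory Submission
  imports "HOL-Analysis.Function_Topology" Defs
begin

text \<open>If there is no fractional \<open>(g,f)\<close>-factor, minimise over \<open>h \<in> [0,1]\<^sup>E\<close> the sum of the
  squared deviations of the vertex sums of \<open>h\<close> from the intervals \<open>[g x, f x]\<close>. The vertices
  where the deviation attains its maximal absolute value with positive (negative) sign form
  sets \<open>S\<close> (\<open>T\<close>) with \<open>f(S) + d\<^bsub>G-S\<^esub>(T) - g(T) < 0\<close>.

  For \<open>G - I - H\<close> no such pair exists. The condition on \<open>\<sigma>\<^sub>2\<close> bounds \<open>|I|\<close>. Let \<open>x1 \<in> T\<close> have
  least degree in \<open>G - I - S\<close>. If the non-neighbours of \<open>x1\<close> in \<open>T\<close> all have degree at least
  \<open>b - \<Delta>\<close> there, only the closed neighbourhood of \<open>x1\<close> contributes negatively and the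
  minimum degree condition makes \<open>S\<close> large enough. Otherwise the \<open>\<sigma>\<^sub>2\<close> condition for \<open>x1\<close>
  and a non-neighbour \<open>x2\<close> of least degree does.\<close>

section \<open>Least-squares weightings and the extremal pair \<open>(S, T)\<close>\<close>

text \<open>Tychonoff's theorem for a power of the unit interval. Coordinates range over the whole
  type, so that total functions carry the product topology directly.\<close>

lemma compact_unit_cube: "compact {h :: 'a \<Rightarrow> real. \<forall>e. 0 \<le> h e \<and> h e \<le> 1}"
proof -
  have "compactin (product_topology (\<lambda>_::'a. euclidean :: real topology) UNIV)
      (PiE UNIV (\<lambda>_. {0..1}))"
    by (subst compactin_PiE) auto
  moreover have "PiE UNIV (\<lambda>_::'a. {0..1::real}) = {h. \<forall>e. 0 \<le> h e \<and> h e \<le> 1}"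
    by (auto simp: PiE_def Pi_def)
  ultimately show ?thesis
    by (simp add: euclidean_product_topology)
qed

text \<open>For \<open>l \<le> u\<close> this is the point of the interval from \<open>l\<close> to
  \<open>u\<close> nearest to \<open>t\<close>.\<close>

definition clamp :: "real \<Rightarrow> real \<Rightarrow> real \<Rightarrow> real" where
  "clamp l u t = max l (min u t)"

text \<open>\<open>clamp l u t\<close> lies in the interval too, so \<open>t + s\<close> is at least
  as close to its own nearest point. This replaces differentiating the squared distance by a
  quadratic upper bound.\<close>

lemma clamp_nearest:
  assumes "l \<le> u"
  shows "(t + s - clamp l u (t + s))\<^sup>2 \<le> (t - clamp l u t + s)\<^sup>2"
proof -
  have "\<bar>t + s - clamp l u (t + s)\<bar> \<le> \<bar>t - clamp l u t + s\<bar>"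
    using assms by (auto simp: clamp_def max_def min_def abs_if)
  then show ?thesis
    by (simp only: abs_le_square_iff)
qed

lemma finite_edges:
  assumes "finite_simple_graph V E"
  shows "finite E"
proof -
  have "E \<subseteq> Pow V" "finite V" using assms by (auto simp: finite_simple_graph_def)
  then show ?thesis using finite_subset by blast
qed

text \<open>Shifting the value of \<open>h\<close> on a single edge shows that the deviations from the
  prescribed intervals act as dual variables (complementary slackness).\<close>

lemma least_squares_weighting_exists:
  fixes l u :: "'a \<Rightarrow> real"
  assumes G: "finite_simple_graph V E" and lu: "\<forall>x\<in>V. l x \<le> u x"
  obtains h y where "\<forall>e. 0 \<le> h e \<and> h e \<le> (1::real)"
    and "\<forall>x. y x = (\<Sum>e | e \<in> E \<and> x \<in> e. h e) - clamp (l x) (u x) (\<Sum>e | e \<in> E \<and> x \<in> e. h e)"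
    and "\<forall>e\<in>E. 0 < (\<Sum>x\<in>e. y x) \<longrightarrow> h e = 0"
    and "\<forall>e\<in>E. (\<Sum>x\<in>e. y x) < 0 \<longrightarrow> h e = 1"
proof -
  define K where "K = {h :: 'a set \<Rightarrow> real. \<forall>e. 0 \<le> h e \<and> h e \<le> 1}"
  define w where "w h x = (\<Sum>e | e \<in> E \<and> x \<in> e. h e)" for h :: "'a set \<Rightarrow> real" and x
  define dev where "dev h x = w h x - clamp (l x) (u x) (w h x)" for h x
  define \<Phi> where "\<Phi> h = (\<Sum>x\<in>V. (dev h x)\<^sup>2)" for h
  have finV: "finite V" and edge: "\<And>e. e \<in> E \<Longrightarrow> e \<subseteq> V \<and> card e = 2"
    using G by (auto simp: finite_simple_graph_def)
  have finE: "finite E" using finite_edges[OF G] .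
  have cont: "continuous_on K \<Phi>"
    unfolding \<Phi>_def dev_def w_def clamp_def
    by (intro continuous_intros continuous_on_subset[OF continuous_on_product_coordinates]) auto
  have "compact K" unfolding K_def by (rule compact_unit_cube)
  moreover have "(\<lambda>_. 0) \<in> K" by (simp add: K_def)
  ultimately obtain h where hK: "h \<in> K" and hmin: "\<And>k. k \<in> K \<Longrightarrow> \<Phi> h \<le> \<Phi> k"
    using continuous_attains_inf[OF _ _ cont] by blast
  \<comment> \<open>Minimality of \<open>h\<close> is tested against changing the single edge
    \<open>e\<close> by \<open>s\<close>. Each of its two ends adds at most
    \<open>2 * s * dev h x + s\<^sup>2\<close> to \<open>\<Phi>\<close>.\<close>
  have shift: "0 \<le> s * ((\<Sum>x\<in>e. dev h x) + s)"
    if e: "e \<in> E" and s: "0 \<le> h e + s" "h e + s \<le> 1" for e s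
  proof -
    let ?k = "h(e := h e + s)"
    have "?k \<in> K" using hK s by (auto simp: K_def)
    then have "\<Phi> h \<le> \<Phi> ?k" by (rule hmin)
    also have "\<Phi> ?k \<le> (\<Sum>x\<in>V. (dev h x)\<^sup>2 + (if x \<in> e then 2 * s * dev h x + s\<^sup>2 else 0))"
      unfolding \<Phi>_def
    proof (rule sum_mono)
      fix x assume x: "x \<in> V"
      have fin: "finite {e' \<in> E. x \<in> e'}" using finE by simp
      have wk: "w ?k x = (if x \<in> e then w h x + s else w h x)"
      proof (cases "x \<in> e")
        case True
        then have "e \<in> {e' \<in> E. x \<in> e'}" using e by simp
        then show ?thesis using True
          unfolding w_def by (simp add: sum.remove[OF fin])
      next
        case False
        then show ?thesis unfolding w_def by (auto intro!: sum.cong)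
      qed
      show "(dev ?k x)\<^sup>2 \<le> (dev h x)\<^sup>2 + (if x \<in> e then 2 * s * dev h x + s\<^sup>2 else 0)"
      proof (cases "x \<in> e")
        case True
        then have "(dev ?k x)\<^sup>2 \<le> (dev h x + s)\<^sup>2"
          unfolding dev_def wk using clamp_nearest lu x by simp
        then show ?thesis using True by (simp add: power2_sum algebra_simps)
      next
        case False
        then show ?thesis unfolding dev_def wk by simp
      qed
    qed
    also have "\<dots> = \<Phi> h + (\<Sum>x\<in>e. 2 * s * dev h x + s\<^sup>2)"
      using finV edge[OF e]
      by (simp add: \<Phi>_def sum.distrib sum.inter_restrict[symmetric] Int_absorb1)
    also have "(\<Sum>x\<in>e. 2 * s * dev h x + s\<^sup>2) = 2 * (s * ((\<Sum>x\<in>e. dev h x) + s))"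
      using edge[OF e] by (simp add: sum.distrib sum_distrib_left[symmetric] power2_eq_square algebra_simps)
    finally show ?thesis by simp
  qed
  have up: "h e = 0" if "e \<in> E" "0 < (\<Sum>x\<in>e. dev h x)" for e
  proof (rule ccontr)
    assume "h e \<noteq> 0"
    then have he: "0 < h e" "h e \<le> 1" using hK by (auto simp: K_def less_le)
    \<comment> \<open>Lowering \<open>h e\<close> by this \<open>s\<close> stays in the unit
      interval, and \<open>s\<close> is below the sum of deviations, so \<open>shift\<close> would
      have a negative right-hand side.\<close>
    define s where "s = min (h e) ((\<Sum>x\<in>e. dev h x) / 2)"
    have "0 < s" "s \<le> h e" "s < (\<Sum>x\<in>e. dev h x)" using he that by (auto simp: s_def)
    then show False using shift[OF that(1), of "- s"] he by (simp add: mult_le_0_iff)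
  qed
  have down: "h e = 1" if "e \<in> E" "(\<Sum>x\<in>e. dev h x) < 0" for e
  proof (rule ccontr)
    assume "h e \<noteq> 1"
    then have he: "0 \<le> h e" "h e < 1" using hK by (auto simp: K_def less_le)
    define s where "s = min (1 - h e) (- (\<Sum>x\<in>e. dev h x) / 2)"
    have "0 < s" "s \<le> 1 - h e" "s < - (\<Sum>x\<in>e. dev h x)" using he that by (auto simp: s_def)
    then show False using shift[OF that(1), of s] he by (simp add: zero_le_mult_iff)
  qed
  show ?thesis
  proof (rule that[of h "dev h"])
    show "\<forall>e. 0 \<le> h e \<and> h e \<le> 1" using hK by (simp add: K_def)
    show "\<forall>x. dev h x = (\<Sum>e | e \<in> E \<and> x \<in> e. h e)
        - clamp (l x) (u x) (\<Sum>e | e \<in> E \<and> x \<in> e. h e)"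
      unfolding dev_def w_def by blast
  qed (use up down in blast)+
qed

text \<open>With \<open>M\<close> the largest absolute deviation, vertex sums are
  \<open>f + M\<close> on \<open>S\<close> and \<open>g - M\<close> on \<open>T\<close>. Slackness
  fixes every other edge at \<open>S\<close> to 0 and at \<open>T\<close> to 1, so the weight
  between \<open>S\<close> and \<open>T\<close> can be computed from both sides. Comparing the
  results gives the value \<open>- M * (card S + card T)\<close>.\<close>

lemma fractional_factor_obstruction:
  assumes G: "finite_simple_graph V E" and gf: "\<forall>x\<in>V. g x \<le> f x"
    and none: "\<nexists>h. fractional_factor V E g f h"
  obtains S T where "S \<subseteq> V" "T \<subseteq> V" "S \<inter> T = {}"
    and "\<forall>x\<in>T. int (degree {e \<in> E. e \<inter> S = {}} x) < g x"
    and "(\<Sum>x\<in>S. f x) + (\<Sum>x\<in>T. int (degree {e \<in> E. e \<inter> S = {}} x) - g x) < 0"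
proof -
  have finV: "finite V" and edge: "\<And>e. e \<in> E \<Longrightarrow> e \<subseteq> V \<and> card e = 2"
    using G by (auto simp: finite_simple_graph_def)
  have finE: "finite E" using finite_edges[OF G] .
  obtain h y where h01: "\<forall>e. 0 \<le> h e \<and> h e \<le> (1::real)"
    and y: "\<forall>x. y x = (\<Sum>e | e \<in> E \<and> x \<in> e. h e)
        - clamp (real_of_int (g x)) (real_of_int (f x)) (\<Sum>e | e \<in> E \<and> x \<in> e. h e)"
    and up: "\<forall>e\<in>E. 0 < (\<Sum>x\<in>e. y x) \<longrightarrow> h e = 0"
    and down: "\<forall>e\<in>E. (\<Sum>x\<in>e. y x) < 0 \<longrightarrow> h e = 1"
  proof (rule least_squares_weighting_exists[OF G, of "\<lambda>x. real_of_int (g x)" "\<lambda>x. real_of_int (f x)"])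
    show "\<forall>x\<in>V. real_of_int (g x) \<le> real_of_int (f x)" using gf by simp
  qed
  define w where "w x = (\<Sum>e | e \<in> E \<and> x \<in> e. h e)" for x
  define M where "M = Max ((\<lambda>x. \<bar>y x\<bar>) ` V)"
  have "\<not> fractional_factor V E g f h" using none by blast
  then obtain x0 where x0: "x0 \<in> V" "\<not> (g x0 \<le> w x0 \<and> w x0 \<le> f x0)"
    using h01 unfolding fractional_factor_def w_def by auto
  have "y x0 \<noteq> 0"
    using x0 y gf by (auto simp: w_def[symmetric] clamp_def max_def min_def split: if_splits)
  moreover have yM: "\<bar>y x\<bar> \<le> M" if "x \<in> V" for x
    using that finV unfolding M_def by (intro Max_ge) auto
  ultimately have Mpos: "0 < M" using x0(1) by fastforce
  have "M \<in> (\<lambda>x. \<bar>y x\<bar>) ` V"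
    unfolding M_def using finV x0(1) by (intro Max_in) auto
  then obtain x1 where x1: "x1 \<in> V" "\<bar>y x1\<bar> = M" by auto
  define S where "S = {x \<in> V. y x = M}"
  define T where "T = {x \<in> V. y x = - M}"
  have ST: "S \<subseteq> V" "T \<subseteq> V" "S \<inter> T = {}" "x1 \<in> S \<union> T"
    using Mpos x1 by (auto simp: S_def T_def)
  have finST: "finite S" "finite T" using ST finV finite_subset by blast+
  have wS: "w x = f x + M" if "x \<in> S" for x
  proof -
    have "x \<in> V" "y x = M" using that by (auto simp: S_def)
    then show ?thesis using y gf Mpos
      by (auto simp: w_def[symmetric] clamp_def max_def min_def split: if_splits)
  qed
  have wT: "w x = g x - M" if "x \<in> T" for x
  proof -
    have "x \<in> V" "y x = - M" using that by (auto simp: T_def)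
    then show ?thesis using y gf Mpos
      by (auto simp: w_def[symmetric] clamp_def max_def min_def split: if_splits)
  qed
  have ends: "(\<Sum>z\<in>e. y z) = y x + y v" if "e = {x, v}" "x \<noteq> v" for e x v
    using that by simp
  have two: "\<exists>v. e = {x, v} \<and> x \<noteq> v \<and> v \<in> V" if "e \<in> E" "x \<in> e" for e x
    using edge[OF that(1)] that(2) by (auto simp: card_2_iff doubleton_eq_iff)
  \<comment> \<open>The other end \<open>v\<close> is outside \<open>T\<close>, hence
    \<open>y v > - M\<close>. Added to \<open>y x = M\<close> this is positive, and slackness
    applies; \<open>hT\<close> is symmetric.\<close>
  have hS: "h e = 0" if e: "e \<in> E" "x \<in> e" and "x \<in> S" "e \<inter> T = {}" for e x
  proof -
    obtain v where v: "e = {x, v}" "x \<noteq> v" "v \<in> V" using two[OF e] by blast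
    have "y v \<noteq> - M" using v that(4) by (auto simp: T_def)
    then have "0 < y x + y v" using yM[OF v(3)] that(3) by (auto simp: S_def)
    then show ?thesis using up that(1) ends[OF v(1,2)] by simp
  qed
  have hT: "h e = 1" if e: "e \<in> E" "x \<in> e" and "x \<in> T" "e \<inter> S = {}" for e x
  proof -
    obtain v where v: "e = {x, v}" "x \<noteq> v" "v \<in> V" using two[OF e] by blast
    have "y v \<noteq> M" using v that(4) by (auto simp: S_def)
    then have "y x + y v < 0" using yM[OF v(3)] that(3) by (auto simp: T_def)
    then show ?thesis using down that(1) ends[OF v(1,2)] by simp
  qed
  \<comment> \<open>The edges between \<open>S\<close> and \<open>T\<close>: each has one end on
    either side, so summing over \<open>S\<close> or over \<open>T\<close> counts it exactly
    once.\<close>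
  define B where "B = {e \<in> E. e \<inter> S \<noteq> {} \<and> e \<inter> T \<noteq> {}}"
  have finB: "finite B" using finE by (simp add: B_def)
  have "card (e \<inter> S) = 1 \<and> card (e \<inter> T) = 1" if "e \<in> B" for e
  proof -
    have e: "e \<in> E" "e \<inter> S \<noteq> {}" "e \<inter> T \<noteq> {}" using that by (auto simp: B_def)
    obtain x where x: "x \<in> e" "x \<in> S" using e by auto
    then obtain v where v: "e = {x, v}" "x \<noteq> v" using two e(1) by blast
    then have "v \<in> T" using e x ST(3) by auto
    then have "e \<inter> S = {x}" "e \<inter> T = {v}" using v x ST(3) by auto
    then show ?thesis by simp
  qed
  then have cB: "card (e \<inter> S) = 1" "card (e \<inter> T) = 1" if "e \<in> B" for e
    using that by auto
  have swap: "(\<Sum>x\<in>X. \<Sum>e | e \<in> B \<and> x \<in> e. h e) = (\<Sum>e\<in>B. h e)"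
    if X: "finite X" "\<And>e. e \<in> B \<Longrightarrow> card (e \<inter> X) = 1" for X
  proof -
    have "(\<Sum>x\<in>X. \<Sum>e | e \<in> B \<and> x \<in> e. h e) = (\<Sum>e\<in>B. \<Sum>x | x \<in> X \<and> x \<in> e. h e)"
      by (rule sum.swap_restrict[OF X(1) finB])
    also have "\<dots> = (\<Sum>e\<in>B. h e)"
    proof (rule sum.cong)
      fix e assume "e \<in> B"
      moreover have "{x \<in> X. x \<in> e} = e \<inter> X" by auto
      ultimately show "(\<Sum>x | x \<in> X \<and> x \<in> e. h e) = h e" using X(2) by simp
    qed simp
    finally show ?thesis .
  qed
  have wSB: "w x = (\<Sum>e | e \<in> B \<and> x \<in> e. h e)" if "x \<in> S" for x
    unfolding w_def using finE that hS
    by (intro sum.mono_neutral_right) (auto simp: B_def)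
  have wTB: "w x = (\<Sum>e | e \<in> B \<and> x \<in> e. h e) + degree {e \<in> E. e \<inter> S = {}} x" if "x \<in> T" for x
  proof -
    have "{e. e \<in> E \<and> x \<in> e} = {e. e \<in> B \<and> x \<in> e} \<union> {e \<in> {e \<in> E. e \<inter> S = {}}. x \<in> e}"
      using that by (auto simp: B_def)
    then have "w x = (\<Sum>e | e \<in> B \<and> x \<in> e. h e) + (\<Sum>e\<in>{e \<in> {e \<in> E. e \<inter> S = {}}. x \<in> e}. h e)"
      unfolding w_def using finE by (subst sum.union_disjoint[symmetric]) (auto simp: B_def)
    also have "(\<Sum>e\<in>{e \<in> {e \<in> E. e \<inter> S = {}}. x \<in> e}. h e) = (\<Sum>e\<in>{e \<in> {e \<in> E. e \<inter> S = {}}. x \<in> e}. 1)"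
      using hT that by (intro sum.cong) auto
    finally show ?thesis by (simp add: degree_def)
  qed
  have "(\<Sum>x\<in>S. f x + M) = (\<Sum>e\<in>B. h e)"
    using swap[of S] finST cB by (simp flip: wS add: wSB)
  moreover have "(\<Sum>x\<in>T. (g x - M) - real (degree {e \<in> E. e \<inter> S = {}} x)) = (\<Sum>e\<in>B. h e)"
    using swap[of T] finST cB by (simp flip: wT add: wTB)
  ultimately have "real_of_int ((\<Sum>x\<in>S. f x) + (\<Sum>x\<in>T. int (degree {e \<in> E. e \<inter> S = {}} x) - g x))
      = - M * (card S + card T)"
    by (simp add: sum.distrib sum_subtractf algebra_simps)
  moreover have "0 < card S + card T" using ST(4) finST by (auto simp: card_gt_0_iff)
  ultimately have neg: "(\<Sum>x\<in>S. f x) + (\<Sum>x\<in>T. int (degree {e \<in> E. e \<inter> S = {}} x) - g x) < 0"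
    using Mpos by (smt (verit) mult_minus_left mult_pos_pos of_int_0_le_iff of_nat_0_less_iff)
  have "int (degree {e \<in> E. e \<inter> S = {}} x) < g x" if "x \<in> T" for x
  proof -
    have "0 \<le> (\<Sum>e | e \<in> B \<and> x \<in> e. h e)" using h01 by (intro sum_nonneg) auto
    then have "real (degree {e \<in> E. e \<inter> S = {}} x) < real_of_int (g x)"
      using wTB[OF that] wT[OF that] Mpos by linarith
    then show ?thesis by linarith
  qed
  then show ?thesis using that[of S T] ST neg by blast
qed

section \<open>Degree counting and the size of independent sets\<close>

lemma degree_le_degree_delete:
  assumes G: "finite_simple_graph V E" and X: "finite X" "x \<notin> X"
  shows "degree E x \<le> degree {e \<in> E. e \<inter> X = {}} x + card X"
proof -
  have finE: "finite E" using finite_edges[OF G] .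
  have "{e \<in> E. x \<in> e} \<subseteq> {e \<in> {e \<in> E. e \<inter> X = {}}. x \<in> e} \<union> (\<lambda>y. {x, y}) ` X"
  proof
    fix e assume e: "e \<in> {e \<in> E. x \<in> e}"
    then have "card e = 2" using G by (auto simp: finite_simple_graph_def)
    then obtain v where "e = {x, v}" using e by (auto simp: card_2_iff)
    then show "e \<in> {e \<in> {e \<in> E. e \<inter> X = {}}. x \<in> e} \<union> (\<lambda>y. {x, y}) ` X"
      using e X(2) by auto
  qed
  then have "degree E x \<le> card ({e \<in> {e \<in> E. e \<inter> X = {}}. x \<in> e} \<union> (\<lambda>y. {x, y}) ` X)"
    unfolding degree_def using finE X by (intro card_mono) auto
  also have "\<dots> \<le> degree {e \<in> E. e \<inter> X = {}} x + card ((\<lambda>y. {x, y}) ` X)"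
    unfolding degree_def by (rule card_Un_le)
  also have "card ((\<lambda>y. {x, y}) ` X) \<le> card X" using X(1) by (rule card_image_le)
  finally show ?thesis by simp
qed

lemma degree_le_degree_Un:
  assumes "finite A" "finite B" "E \<subseteq> A \<union> B"
  shows "degree E x \<le> degree A x + degree B x"
proof -
  have "degree E x \<le> card ({e \<in> A. x \<in> e} \<union> {e \<in> B. x \<in> e})"
    unfolding degree_def using assms by (intro card_mono) auto
  also have "\<dots> \<le> degree A x + degree B x" unfolding degree_def by (rule card_Un_le)
  finally show ?thesis .
qed

lemma degree_le_card: "finite E \<Longrightarrow> degree E x \<le> card E"
  unfolding degree_def by (auto intro: card_mono)

lemma sum_degree_le:
  assumes "finite T" "finite E" "\<forall>e\<in>E. card e = 2"
  shows "(\<Sum>x\<in>T. degree E x) \<le> 2 * card E"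
proof -
  have "(\<Sum>x\<in>T. degree E x) = (\<Sum>x\<in>T. \<Sum>e | e \<in> E \<and> x \<in> e. 1)"
    by (simp add: degree_def)
  also have "\<dots> = (\<Sum>e\<in>E. \<Sum>x | x \<in> T \<and> x \<in> e. 1)"
    by (rule sum.swap_restrict[OF assms(1,2)])
  also have "\<dots> \<le> (\<Sum>e\<in>E. 2)"
  proof (rule sum_mono)
    fix e assume "e \<in> E"
    then have "card e = 2" "finite e" using assms(3) by (auto intro: card_ge_0_finite)
    moreover have "card {x \<in> T. x \<in> e} \<le> card e" using \<open>finite e\<close> by (intro card_mono) auto
    ultimately show "(\<Sum>x | x \<in> T \<and> x \<in> e. 1) \<le> (2::nat)" by simp
  qed
  finally show ?thesis by simp
qed

lemma card_closed_neighbourhood_le: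
  assumes "finite E" "finite T"
  shows "card {y \<in> T. y = x \<or> {x, y} \<in> E} \<le> degree E x + 1"
proof -
  have "card {y \<in> T. y = x \<or> {x, y} \<in> E} \<le> card (insert x {y \<in> T. {x, y} \<in> E})"
    using assms by (intro card_mono) auto
  also have "\<dots> \<le> card {y \<in> T. {x, y} \<in> E} + 1" using assms by (simp add: card_insert_if)
  also have "card {y \<in> T. {x, y} \<in> E} \<le> degree E x"
    unfolding degree_def using assms
    by (intro card_inj_on_le[of "\<lambda>y. {x, y}"]) (auto simp: inj_on_def doubleton_eq_iff)
  finally show ?thesis by simp
qed

text \<open>Replacing \<open>card P\<close> by its upper bound \<open>k\<close> only lowers the
  estimate, because \<open>\<alpha> \<le> \<beta>\<close>. It is applied with \<open>P\<close> the
  closed neighbourhood of \<open>x1\<close> in \<open>T\<close>.\<close>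

lemma sum_ge_two_levels:
  fixes d :: "'a \<Rightarrow> real"
  assumes "finite T" "P \<subseteq> T" "real (card P) \<le> k" "\<alpha> \<le> \<beta>"
    and "\<forall>x\<in>P. \<alpha> \<le> d x" "\<forall>x\<in>T - P. \<beta> \<le> d x"
  shows "\<beta> * card T - k * (\<beta> - \<alpha>) \<le> (\<Sum>x\<in>T. d x)"
proof -
  have finP: "finite P" using assms finite_subset by blast
  have "(\<Sum>x\<in>P. \<alpha>) \<le> (\<Sum>x\<in>P. d x)" "(\<Sum>x\<in>T - P. \<beta>) \<le> (\<Sum>x\<in>T - P. d x)"
    using assms by (intro sum_mono; simp)+
  moreover have "(\<Sum>x\<in>T. d x) = (\<Sum>x\<in>T - P. d x) + (\<Sum>x\<in>P. d x)"
    using assms by (intro sum.subset_diff) auto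
  moreover have "\<beta> * card (T - P) = \<beta> * card T - \<beta> * card P"
    using assms finP by (simp add: card_Diff_subset card_mono of_nat_diff right_diff_distrib)
  moreover have "0 \<le> (k - card P) * (\<beta> - \<alpha>)" using assms by simp
  ultimately show ?thesis
    by (simp add: left_diff_distrib right_diff_distrib mult.commute del: card_Diff_subset)
qed

text \<open>A vertex of \<open>I\<close> has all its neighbours outside \<open>I\<close>. For two
  vertices of \<open>I\<close>, the degree sum is thus at most \<open>2 * (card V - card I)\<close>,
  and the bound on nonadjacent pairs leaves room for at most \<open>c * N\<close> vertices.\<close>

lemma card_independent_set_le:
  fixes c q N :: real
  assumes G: "finite_simple_graph V E" and I: "independent_set V E I"
    and n: "card V = (q + 2 * c) * N" and N: "1 \<le> c * N"
    and sigma: "\<And>u v. u \<in> V \<Longrightarrow> v \<in> V \<Longrightarrow> u \<noteq> v \<Longrightarrow> {u, v} \<notin> E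
      \<Longrightarrow> 2 * (c + q) * N \<le> real (degree E u + degree E v)"
  shows "card I \<le> c * N"
proof (cases "card I \<le> 1")
  case True
  then show ?thesis using N by linarith
next
  case False
  have finV: "finite V" using G by (simp add: finite_simple_graph_def)
  have IV: "I \<subseteq> V" and ind: "\<And>u v. u \<in> I \<Longrightarrow> v \<in> I \<Longrightarrow> {u, v} \<notin> E"
    using I by (auto simp: independent_set_def)
  have finI: "finite I" using finV IV finite_subset by blast
  obtain u v where uv: "u \<in> I" "v \<in> I" "u \<noteq> v"
    using False card_le_Suc0_iff_eq[OF finI] by auto
  have bound: "degree E x + card I \<le> card V" if "x \<in> I" for x
  proof -
    have "{e \<in> {e \<in> E. e \<inter> (V - I) = {}}. x \<in> e} = {}"
    proof (rule ccontr)
      assume "{e \<in> {e \<in> E. e \<inter> (V - I) = {}}. x \<in> e} \<noteq> {}"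
      then obtain e where e: "e \<in> E" "e \<inter> (V - I) = {}" "x \<in> e" by blast
      then have "e \<subseteq> V" "card e = 2" using G by (auto simp: finite_simple_graph_def)
      moreover from this e(3) obtain w where "e = {x, w}" by (auto simp: card_2_iff)
      ultimately show False using ind[OF that, of w] e by auto
    qed
    then have "degree {e \<in> E. e \<inter> (V - I) = {}} x = 0" by (simp only: degree_def card.empty)
    then have "degree E x \<le> card (V - I)"
      using degree_le_degree_delete[OF G, of "V - I" x] finV that by simp
    then show ?thesis
      using card_Diff_subset[OF finI IV] card_mono[OF finV IV] by simp
  qed
  have "2 * (c + q) * N \<le> real (degree E u + degree E v)"
    using sigma uv ind IV by blast
  moreover have "real (degree E u + degree E v) + 2 * card I \<le> 2 * card V"
    using bound[OF uv(1)] bound[OF uv(2)] by linarith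
  ultimately show ?thesis using n by (simp add: algebra_simps)
qed

section \<open>Arithmetic of the cases for the non-neighbours of \<open>x1\<close>\<close>

text \<open>Here \<open>d\<close> is the least degree and \<open>s\<close> the size of
  \<open>S\<close>. After \<open>d + 1 \<le> q\<close> and \<open>2 \<le> c\<close>, what remains is
  \<open>(b - q) * (q - d) + (b - c) * d\<close>.\<close>

lemma near_case_low:
  fixes b c d m q s :: real
  assumes "2 \<le> c" "c \<le> b" "q \<le> b" "0 \<le> d" "d + 1 \<le> q" "0 \<le> m"
    and "b * q + c * m \<le> c * (s + d)"
  shows "0 \<le> c * s - (d + 1) * (q - d) - 2 * m"
proof -
  have "(d + 1) * (q - d) \<le> q * (q - d)" using assms by (intro mult_right_mono) auto
  moreover have "2 * m \<le> c * m" using assms by (intro mult_right_mono) auto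
  moreover have "0 \<le> (b - q) * (q - d)" "0 \<le> (b - c) * d" using assms by auto
  ultimately show ?thesis using assms(7) by (simp add: algebra_simps)
qed

text \<open>The remainder is \<open>(c - r) * (m - (d - q)) + (b - c) * q\<close>; here
  \<open>r\<close> is the number of vertices of \<open>T\<close> whose surplus is kept, at most
  2.\<close>

lemma near_case_high:
  fixes b c d m q r s :: real
  assumes "r \<le> c" "c \<le> b" "0 \<le> q" "d \<le> q + m"
    and "b * q + c * m \<le> c * (s + d)"
  shows "0 \<le> c * s + r * (d - q) - r * m"
proof -
  have "0 \<le> (c - r) * (m - (d - q))" "0 \<le> (b - c) * q" using assms by auto
  then show ?thesis using assms(5) by (simp add: algebra_simps)
qed

text \<open>A linear program in \<open>s\<close>, \<open>t\<close>, \<open>i\<close>, the sizes of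
  \<open>S\<close>, \<open>T\<close>, \<open>I\<close>. The dual multipliers are
  \<open>q - d2\<close> for the vertex count, \<open>(c + q - d2) / 2\<close> for the degree sum and
  \<open>c\<close> for the bound on \<open>i\<close>.\<close>

lemma far_case_linear:
  fixes c d1 d2 i N q s t :: real
  assumes "0 \<le> c" "i \<le> c * N" "d2 \<le> q"
    and s: "2 * (c + q) * N \<le> 2 * s + 2 * i + d1 + d2"
    and t: "s + t + i \<le> (q + 2 * c) * N"
  shows "d2 * (c * N) - (c + q - d2) * (d1 + d2) / 2 \<le> c * s + (d2 - q) * t"
proof -
  have "0 \<le> (q - d2) * ((q + 2 * c) * N - i - s - t)" using assms by simp
  moreover have "0 \<le> (c + q - d2) * (2 * s + 2 * i + d1 + d2 - 2 * (c + q) * N)"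
    using assms by simp
  moreover have "0 \<le> c * (c * N - i)" using assms by simp
  moreover have "c * s + (d2 - q) * t - (d2 * (c * N) - (c + q - d2) * (d1 + d2) / 2)
    = (q - d2) * ((q + 2 * c) * N - i - s - t)
      + (c + q - d2) * (2 * s + 2 * i + d1 + d2 - 2 * (c + q) * N) / 2 + c * (c * N - i)"
    by (simp add: field_simps)
  ultimately show ?thesis by linarith
qed

text \<open>With \<open>d = d2\<close> and \<open>k = d2 - d1\<close> the core is
  \<open>d * (d - 2) + k * (k - d)\<close>. For \<open>d \<ge> 2\<close> completing the square in
  \<open>k\<close> leaves \<open>(3 * d - 2) * (d - 2)\<close>; for \<open>d = 1\<close> integrality
  of \<open>k\<close> is essential, and \<open>- 1\<close> is attained by the core.\<close>

lemma far_case_quadratic: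
  fixes c m q :: real and d1 d2 :: nat
  assumes "2 \<le> c" "d2 \<le> q" "d1 \<le> d2" "1 \<le> d2" "0 \<le> m"
  shows "- 1 \<le> d2 * (c + q + 2 * m - 2) - (c + q - d2) * (d1 + d2) / 2
    - (real d1 + 1) * (real d2 - real d1) - 2 * m"
proof -
  define k where "k = real d2 - real d1"
  define d where "d = real d2"
  have k: "0 \<le> k" "real d1 = d - k" using assms by (auto simp: k_def d_def)
  have "0 \<le> k * ((c + q - d) / 2 - 1)" using assms k by (auto simp: d_def)
  moreover have "0 \<le> 2 * m * (d - 1)" using assms by (auto simp: d_def)
  moreover have "- 1 \<le> d * (d - 2) + k * (k - d)"
  proof (cases "d2 = 1")
    case True
    then have "d = 1" "k = 0 \<or> k = 1" using assms by (auto simp: d_def k_def le_Suc_eq)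
    then show ?thesis by auto
  next
    case False
    then have "0 \<le> (3 * d - 2) * (d - 2)" using assms by (auto simp: d_def)
    moreover have "0 \<le> (2 * k - d)\<^sup>2" by simp
    ultimately show ?thesis by (simp add: algebra_simps power2_eq_square)
  qed
  moreover have "d2 * (c + q + 2 * m - 2) - (c + q - d2) * (d1 + d2) / 2
      - (real d1 + 1) * (real d2 - real d1) - 2 * m
    = d * (d - 2) + k * (k - d) + k * ((c + q - d) / 2 - 1) + 2 * m * (d - 1)"
    unfolding of_nat_add k(2) d_def[symmetric] by (simp add: field_simps)
  ultimately show ?thesis by linarith
qed

section \<open>Excluding a pair \<open>(S, T)\<close> in \<open>G - I - H\<close>\<close>

text \<open>In the application \<open>c = a + \<Delta>\<close>, \<open>q = b - \<Delta>\<close> and \<open>N = n / (b + 2 a + \<Delta>)\<close>.\<close>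

lemma no_obstruction:
  fixes b c N :: real and q :: int
  assumes G: "finite_simple_graph V E" and I: "independent_set V E I"
    and H: "H \<subseteq> {e \<in> E. e \<inter> I = {}}" "card H = m"
    and ST: "S \<subseteq> V - I" "T \<subseteq> V - I" "S \<inter> T = {}" "T \<noteq> {}"
    and c: "2 \<le> c" "c \<le> b" and q: "2 \<le> q" "q \<le> b"
    and n: "card V = (q + 2 * c) * N" and N: "c + q + 2 * m - 2 < c * N"
    and delta: "\<And>x. x \<in> V \<Longrightarrow> c * N + b * q / c + m \<le> degree E x"
    and sigma: "\<And>u v. u \<in> V \<Longrightarrow> v \<in> V \<Longrightarrow> u \<noteq> v \<Longrightarrow> {u, v} \<notin> E
      \<Longrightarrow> 2 * (c + q) * N \<le> real (degree E u + degree E v)"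
    and small: "\<And>x. x \<in> T
      \<Longrightarrow> int (degree {e \<in> {e \<in> E. e \<inter> I = {}} - H. e \<inter> S = {}} x) < q"
  shows "- 1 < c * card S
    + (\<Sum>x\<in>T. real (degree {e \<in> {e \<in> E. e \<inter> I = {}} - H. e \<inter> S = {}} x) - q)"
proof -
  define F where "F = {e \<in> E. e \<inter> (I \<union> S) = {}}"
  \<comment> \<open>\<open>d\<close> ignores the deletion of \<open>H\<close>, whose total cost on
    \<open>T\<close> is bounded separately; \<open>d'\<close> takes it into account.\<close>
  define d where "d x = degree F x" for x
  define d' where "d' x = degree {e \<in> {e \<in> E. e \<inter> I = {}} - H. e \<inter> S = {}} x" for x
  have finV: "finite V" using G by (simp add: finite_simple_graph_def)
  have finE: "finite E" using finite_edges[OF G] .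
  have IV: "I \<subseteq> V" using I by (simp add: independent_set_def)
  have fin: "finite I" "finite S" "finite T" "finite F" "finite H"
    using finV finE IV ST H by (auto simp: F_def intro: finite_subset)
  have iN: "card I \<le> c * N"
    using c q N by (intro card_independent_set_le[OF G I n _ sigma]) auto
  have deg: "degree E x \<le> d x + card S + card I" if "x \<in> T" for x
  proof -
    have "x \<notin> I \<union> S" using that ST by blast
    then show ?thesis
      using degree_le_degree_delete[OF G, of "I \<union> S" x] fin card_Un_le[of I S]
      unfolding d_def F_def by simp
  qed
  \<comment> \<open>The term \<open>c * N\<close> of the minimum degree condition pays for the
    neighbours lost in \<open>I\<close>.\<close>
  have near: "b * q + c * m \<le> c * (card S + d x)" if "x \<in> T" for x
  proof -
    have "b * q / c + m \<le> card S + d x"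
      using delta[of x] deg[OF that] iN that ST by fastforce
    then have "c * (b * q / c + m) \<le> c * (card S + d x)"
      using c by (intro mult_left_mono) auto
    then show ?thesis using c by (simp add: distrib_left)
  qed
  have dd': "d x \<le> d' x + degree H x" for x
    unfolding d_def d'_def F_def using finE fin by (intro degree_le_degree_Un) auto
  have "(\<Sum>x\<in>T. degree H x) \<le> 2 * m"
    using sum_degree_le[OF fin(3,5)] H G by (auto simp: finite_simple_graph_def)
  moreover have degH: "degree H x \<le> m" for x using degree_le_card fin H by metis
  then have "(\<Sum>x\<in>T. degree H x) \<le> card T * m" using sum_bounded_above[of T "degree H" m] by simp
  \<comment> \<open>An edge of \<open>H\<close> is counted at most twice, but only once if
    \<open>T\<close> is a single vertex. This refinement matters when
    \<open>d x1 \<ge> q\<close>.\<close>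
  ultimately have loss: "(\<Sum>x\<in>T. degree H x) \<le> min 2 (card T) * m"
    by (simp add: min_def)
  have "(\<Sum>x\<in>T. d x) \<le> (\<Sum>x\<in>T. d' x + degree H x)" by (intro sum_mono dd')
  then have "(\<Sum>x\<in>T. d x) \<le> (\<Sum>x\<in>T. d' x) + min 2 (card T) * m"
    using loss by (simp add: sum.distrib)
  then have "(\<Sum>x\<in>T. real (d x)) \<le> (\<Sum>x\<in>T. real (d' x)) + min 2 (card T) * m"
    by (metis of_nat_add of_nat_le_iff of_nat_sum)
  then have sumd: "(\<Sum>x\<in>T. real (d x)) \<le> (\<Sum>x\<in>T. real (d' x)) + min 2 (real (card T)) * m"
    by (simp add: min_def split: if_splits)
  have "min 2 (real (card T)) * m \<le> 2 * real m" by (intro mult_right_mono) auto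
  with sumd have sumd2: "(\<Sum>x\<in>T. real (d x)) \<le> (\<Sum>x\<in>T. real (d' x)) + 2 * real m" by linarith
  obtain x1 where x1: "x1 \<in> T" "\<And>x. x \<in> T \<Longrightarrow> d x1 \<le> d x"
    using fin(3) ST(4) by (metis arg_min_if_finite(1) arg_min_least)
  define P where "P = {y \<in> T. y = x1 \<or> {x1, y} \<in> F}"
  have P: "P \<subseteq> T" "real (card P) \<le> real (d x1) + 1"
    using card_closed_neighbourhood_le[OF fin(4,3), of x1] by (auto simp: P_def d_def)
  have total: "c * card S + (\<Sum>x\<in>T. real (d' x) - q)
      = c * card S + (\<Sum>x\<in>T. real (d' x)) - real_of_int q * real (card T)"
    by (simp add: sum_subtractf)
  have "- 1 < c * card S + (\<Sum>x\<in>T. real (d' x)) - real_of_int q * real (card T)"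
  proof (cases "\<forall>x\<in>T - P. q \<le> int (d x)")
    case far_high: True
    show ?thesis
    proof (cases "int (d x1) < q")
      case True
      have "real_of_int q * real (card T) - (real (d x1) + 1) * (real_of_int q - real (d x1))
          \<le> (\<Sum>x\<in>T. real (d x))"
        using True far_high x1 P fin(3) by (intro sum_ge_two_levels[of _ P]) force+
      moreover have "0 \<le> c * card S - (real (d x1) + 1) * (real_of_int q - real (d x1)) - 2 * real m"
        using near[OF x1(1)] c q True by (intro near_case_low[of c b]) auto
      ultimately show ?thesis using sumd2 by linarith
    next
      case False
      \<comment> \<open>All terms \<open>d x - q\<close> are nonnegative here, so keeping the
        surplus of \<open>r\<close> vertices suffices to match the loss
        \<open>r * m\<close>.\<close>
      define r where "r = min 2 (real (card T))"
      have "(\<Sum>x\<in>T. real (d x1))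
          \<le> (\<Sum>x\<in>T. real (d x))" using x1 by (intro sum_mono) auto
      then have "real (card T) * (real (d x1) - real_of_int q) + real_of_int q * real (card T)
          \<le> (\<Sum>x\<in>T. real (d x))"
        by (simp add: algebra_simps)
      moreover have "r * (real (d x1) - real_of_int q) \<le> real (card T) * (real (d x1) - real_of_int q)"
        using False by (intro mult_right_mono) (auto simp: r_def)
      moreover have "0 \<le> c * card S + r * (real (d x1) - real_of_int q) - r * m"
      proof (rule near_case_high)
        show "real (d x1) \<le> real_of_int q + m"
          using small[OF x1(1), folded d'_def] dd'[of x1] degH[of x1] by linarith
      qed (use near[OF x1(1)] c q in \<open>auto simp: r_def\<close>)
      ultimately show ?thesis using sumd by (simp add: r_def)
    qed
  next
    case False
    then have "T - P \<noteq> {}" by auto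
    then obtain x2 where x2: "x2 \<in> T - P" "\<And>x. x \<in> T - P \<Longrightarrow> d x2 \<le> d x"
      using fin(3) by (metis arg_min_if_finite(1) arg_min_least finite_Diff)
    have x2q: "int (d x2) < q" using False x2 by fastforce
    have d12: "d x1 \<le> d x2" using x1 x2 by auto
    \<comment> \<open>Both vertices avoid \<open>I\<close> and \<open>S\<close>, so an edge of
      \<open>E\<close> joining them would lie in \<open>F\<close> and put \<open>x2\<close> into
      \<open>P\<close>.\<close>
    have "x1 \<noteq> x2" "{x1, x2} \<notin> E"
      using x1 x2 ST by (auto simp: P_def F_def)
    then have "2 * (c + q) * N \<le> real (degree E x1 + degree E x2)"
      using sigma x1 x2 ST by blast
    then have s: "2 * (c + q) * N \<le> 2 * real (card S) + 2 * real (card I) + d x1 + d x2"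
      using deg[of x1] deg[of x2] x1 x2 by auto
    have "(S \<union> T) \<inter> I = {}" using ST by blast
    then have "card S + card T + card I = card (S \<union> T \<union> I)"
      using ST(3) fin by (simp add: card_Un_disjoint)
    also have "\<dots> \<le> card V" using ST IV finV by (intro card_mono) auto
    finally have "real (card S) + card T + card I \<le> (q + 2 * c) * N"
      using n by linarith
    then have lin: "d x2 * (c * N) - (c + q - d x2) * (real (d x1) + d x2) / 2
        \<le> c * card S + (real (d x2) - q) * card T"
      using c iN x2q s by (intro far_case_linear) auto
    \<comment> \<open>For \<open>d x2 = 0\<close> also \<open>d x1 = 0\<close>, and
      \<open>lin\<close> alone gives a nonnegative value. Otherwise the strict bound on
      \<open>N\<close>, multiplied by \<open>d x2 > 0\<close>, makes the final inequality
      strict.\<close>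
    show ?thesis
    proof (cases "d x2 = 0")
      case True
      have "0 \<le> (\<Sum>x\<in>T. real (d' x))" by (intro sum_nonneg) auto
      then show ?thesis using lin True d12 by simp
    next
      case False
      have "real (d x2) * real (card T) - (real (d x1) + 1) * (real (d x2) - real (d x1))
          \<le> (\<Sum>x\<in>T. real (d x))"
        using x1 x2 d12 P fin(3) by (intro sum_ge_two_levels[of _ P]) auto
      moreover have "d x2 * (c + q + 2 * real m - 2) < d x2 * (c * N)"
        using N False by (intro mult_strict_left_mono) auto
      moreover have "- 1 \<le> d x2 * (c + q + 2 * real m - 2) - (c + q - d x2) * (d x1 + d x2) / 2
          - (real (d x1) + 1) * (real (d x2) - real (d x1)) - 2 * real m"
        using c x2q d12 False by (intro far_case_quadratic) auto
      ultimately show ?thesis using lin sumd2 by (simp add: algebra_simps)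
    qed
  qed
  then show ?thesis unfolding d'_def[symmetric] total .
qed

section \<open>From the numerical hypotheses to ID-deletedness\<close>

theorem theorem6:
  fixes V :: "'a set" and E :: "'a set set"
    and n b \<Delta> a m :: nat
    and g f :: "'a \<Rightarrow> int"
  assumes "finite_simple_graph V E"
    and "card V = n"
    and "int b - int \<Delta> \<ge> int a" and "a \<ge> 2"
    and "real (min_degree V E) \<ge>
           (real \<Delta> + real a) * real n / (real b + 2 * real a + real \<Delta>)
           + real b * (real b - real \<Delta>) / (real a + real \<Delta>) + real m"
    and "real n > (real b + 2 * real m + real a - 2) * (real b + real \<Delta> + 2 * real a)
           / (real \<Delta> + real a)"
    and "\<forall>x\<in>V. int b - int \<Delta> \<ge> f x - int \<Delta> \<and> f x - int \<Delta> \<ge> g x \<and> g x \<ge> int a"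
    and "sigma2 V E \<ge>
           ereal (2 * (real b + real a) * real n / (real b + 2 * real a + real \<Delta>))"
  shows "fractional_ID_deleted V E g f m"
proof -
  define c where "c = real a + real \<Delta>"
  define q where "q = int b - int \<Delta>"
  define N where "N = real n / (real b + 2 * real a + real \<Delta>)"
  have ba: "int a + int \<Delta> \<le> int b" "2 \<le> int a" using assms(3,4) by auto
  have c: "2 \<le> c" "c \<le> b" and q: "2 \<le> q" "real_of_int q \<le> b"
    using ba by (auto simp: c_def q_def)
  have den: "real b + 2 * real a + real \<Delta> = q + 2 * c" "real b + real a = c + q"
    by (auto simp: c_def q_def)
  have pos: "0 < q + 2 * c" using c q by linarith
  have N: "N = n / (q + 2 * c)" unfolding N_def den ..
  have nN: "card V = (q + 2 * c) * N" using assms(2) pos by (simp add: N)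
  have cN: "c + q + 2 * real m - 2 < c * N"
  proof -
    have "(c + q + 2 * real m - 2) * (q + 2 * c) / c < n"
      using assms(6) by (simp add: c_def q_def algebra_simps)
    then show ?thesis using c pos by (simp add: N field_simps)
  qed
  have finV: "finite V" using assms(1) by (simp add: finite_simple_graph_def)
  have delta: "c * N + real b * real_of_int q / c + m \<le> degree E x" if "x \<in> V" for x
  proof -
    have "min_degree V E \<le> degree E x"
      unfolding min_degree_def using finV that by (intro Min_le) auto
    moreover have "c * N + real b * real_of_int q / c + m \<le> min_degree V E"
      using assms(5) by (simp add: N_def c_def q_def add.commute)
    ultimately show ?thesis by linarith
  qed
  have sigma: "2 * (c + q) * N \<le> real (degree E u + degree E v)"
    if "u \<in> V" "v \<in> V" "u \<noteq> v" "{u, v} \<notin> E" for u v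
  proof -
    have "sigma2 V E \<le> ereal (real (degree E u + degree E v))"
      unfolding sigma2_def using that by (intro Inf_lower) blast
    then have "ereal (2 * (real b + real a) * real n / (real b + 2 * real a + real \<Delta>))
        \<le> ereal (real (degree E u + degree E v))"
      using assms(8) order_trans by blast
    then show ?thesis by (simp add: den N)
  qed
  have "\<exists>h. fractional_factor (V - I) ({e \<in> E. e \<inter> I = {}} - H) g f h"
    if I: "independent_set V E I" and H: "H \<subseteq> {e \<in> E. e \<inter> I = {}}" "card H = m" for I H
  proof (rule ccontr)
    assume none: "\<nexists>h. fractional_factor (V - I) ({e \<in> E. e \<inter> I = {}} - H) g f h"
    have G': "finite_simple_graph (V - I) ({e \<in> E. e \<inter> I = {}} - H)"
      using assms(1) by (auto simp: finite_simple_graph_def)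
    have "\<forall>x\<in>V - I. g x \<le> f x" using assms(7) by fastforce
    from fractional_factor_obstruction[OF G' this none]
    obtain S T where ST: "S \<subseteq> V - I" "T \<subseteq> V - I" "S \<inter> T = {}"
      and small: "\<forall>x\<in>T. int (degree {e \<in> {e \<in> E. e \<inter> I = {}} - H. e \<inter> S = {}} x) < g x"
      and neg: "(\<Sum>x\<in>S. f x)
        + (\<Sum>x\<in>T. int (degree {e \<in> {e \<in> E. e \<inter> I = {}} - H. e \<inter> S = {}} x) - g x) < 0"
      by blast
    define d' where "d' x = degree {e \<in> {e \<in> E. e \<inter> I = {}} - H. e \<inter> S = {}} x" for x
    \<comment> \<open>From \<open>f x \<le> b\<close> and \<open>g x \<le> f x - \<Delta>\<close>;
      likewise \<open>a \<le> g x\<close> yields the lower bound \<open>a + \<Delta>\<close> on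
      \<open>f\<close> used next.\<close>
    have gq: "g x \<le> q" if "x \<in> T" for x using assms(7) ST that by (fastforce simp: q_def)
    have fS: "(int a + int \<Delta>) * card S \<le> (\<Sum>x\<in>S. f x)"
    proof -
      have "(\<Sum>x\<in>S. int a + int \<Delta>) \<le> (\<Sum>x\<in>S. f x)"
        using assms(7) ST by (intro sum_mono) fastforce
      then show ?thesis by (simp add: mult.commute)
    qed
    have gT: "(\<Sum>x\<in>T. int (d' x) - q) \<le> (\<Sum>x\<in>T. int (d' x) - g x)"
      using gq by (intro sum_mono) auto
    have "T \<noteq> {}"
    proof
      assume "T = {}"
      then have "(int a + int \<Delta>) * card S < 0" using neg fS by simp
      then show False by (simp add: mult_less_0_iff)
    qed
    then have "- 1 < c * card S + (\<Sum>x\<in>T. real (d' x) - q)"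
      unfolding d'_def
    proof (intro no_obstruction[OF assms(1) I H ST _ c q nN cN delta sigma])
      show "int (degree {e \<in> {e \<in> E. e \<inter> I = {}} - H. e \<inter> S = {}} x) < q" if "x \<in> T" for x
        using small gq that by fastforce
    qed
    also have "\<dots> = real_of_int ((int a + int \<Delta>) * card S + (\<Sum>x\<in>T. int (d' x) - q))"
      by (simp add: c_def)
    \<comment> \<open>A negative integer is at most \<open>- 1\<close>, so the strict real bound
      \<open>- 1 <\<close> already gives the contradiction.\<close>
    also have "\<dots> \<le> real_of_int (- 1)"
      using neg fS gT unfolding d'_def[symmetric] of_int_le_iff by linarith
    finally show False by simp
  qed
  then show ?thesis
    unfolding fractional_ID_deleted_def fractional_deleted_def by blast
qed

end
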